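(* Let $(M,d_M)$ be a metric space, let $L,\epsilon\ge 0$, and let $(X,f),(Y,g)$ be $M$-metric fields with $(L,\epsilon)$-connectivity. Let $r,s\ge0$, let $\mathcal{R}\subset X\times Y$ be an $(r,s)$-correspondence between $(X,f)$ and $(Y,g)$, and let $\mathcal{S}:=\{([x],[y]):(x,y)\in\mathcal{R}\}$ be the induced correspondence between the Reeb spaces $R_f$ and $R_g$. Then $\mathcal{S}$ is a $(2Lr+2s+2\epsilon,\ r,\ 2Lr+2s+2\epsilon)$-correspondence between $(R_f,D_f)$ and $(R_g,D_g)$.
   Context: $M$-metric field: a pair $(X,f)$ with $(X,d_X)$ a nonempty compact, connected, locally path connected metric space and $f:X\to M$ continuous. Reeb radius: $\rho_f(x,y):=\inf_\gamma\sup_{t} d_M(f(x),f(\gamma(t)))$, over all continuous paths $\gamma:[0,1]\to X$ from $x$ to $y$. $(L,\epsilon)$-connectivity: $\rho_f(x,y)\le L\,d_X(x,y)+2\epsilon$ for all $x,y\in X$. Reeb space: $R_f=X/\!\sim$, with $x\sim x'$ iff $x,x'$ lie in the same connected component of a level set of $f$; $[x]$ is the class of $x$. Equivalently $[x]=[y]$ iff $\rho_f(x,y)=0$, and $\rho_f(x,y)$ depends only on $[x],[y]$. $R_f$ carries the metric $d_f([x],[y]):=2\max(\rho_f(x,y),\rho_f(y,x))$. Filtration decoration: $D_f([x]):=(X,\rho_f(x,\cdot))$, the metric space $(X,d_X)$ with the real-valued function $y\mapsto\rho_f(x,y)$. A correspondence between sets $X,Y$ is a subset of $X\times Y$ whose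 two coordinate projections are surjective. For metric spaces $X,Y$ with functions $f:X\to M$, $g:Y\to M$, an $(r,s)$-correspondence between $(X,f)$ and $(Y,g)$ is a correspondence $\mathcal{R}$ such that for all $(x,y),(x',y')\in\mathcal{R}$: $|d_X(x,x')-d_Y(y,y')|\le 2r$ and $d_M(f(x),g(y))\le s$. (The same definition is used with $M$ replaced by $\mathbb{R}$ when comparing decorations.) For metric spaces $A,B$ with functions $D_A,D_B$ assigning to each point a metric space with a real-valued function, a correspondence $\mathcal{S}$ between $A$ and $B$ is an $(r,s,t)$-correspondence between $(A,D_A)$ and $(B,D_B)$ if for all $(a,b),(a',b')\in\mathcal{S}$: $|d_A(a,a')-d_B(b,b')|\le 2r$ and there is an $(s,t)$-correspondence between $D_A(a)$ and $D_B(b)$. *)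

theory Defs
  imports "HOL-Analysis.Analysis"
begin

text \<open>
  Metric spaces are rendered by the library type \<open>'a metric\<close>, so that the Reeb space, whose points
  are subsets of the original space, is again a metric space. The quantities \<open>reeb_radius\<close>,
  \<open>reeb_metric\<close> and \<open>reeb_decoration\<close> are meaningful for metric fields only; for these, the
  lemmas at the end of the theory show that they are well defined.
\<close>

locale metric_field =
  fixes M :: "'m metric" and X :: "'x metric" and f :: "'x \<Rightarrow> 'm"
  assumes nonempty: "mspace X \<noteq> {}"
    and compact: "compact_space (mtopology_of X)"
    and connected: "connected_space (mtopology_of X)"
    and locally_path_connected: "locally_path_connected_space (mtopology_of X)"
    and continuous: "continuous_map (mtopology_of X) (mtopology_of M) f"

definition reeb_radius :: "'m metric \<Rightarrow> 'x metric \<Rightarrow> ('x \<Rightarrow> 'm) \<Rightarrow> 'x \<Rightarrow> 'x \<Rightarrow> real" where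
  "reeb_radius M X f x y =
     (INF \<gamma> \<in> {\<gamma>. pathin (mtopology_of X) \<gamma> \<and> \<gamma> 0 = x \<and> \<gamma> 1 = y}.
        SUP t \<in> {0..1}. mdist M (f x) (f (\<gamma> t)))"

definition has_connectivity ::
    "real \<Rightarrow> real \<Rightarrow> 'm metric \<Rightarrow> 'x metric \<Rightarrow> ('x \<Rightarrow> 'm) \<Rightarrow> bool" where
  "has_connectivity L \<epsilon> M X f \<longleftrightarrow>
     (\<forall>x \<in> mspace X. \<forall>y \<in> mspace X. reeb_radius M X f x y \<le> L * mdist X x y + 2 * \<epsilon>)"

definition reeb_rel :: "'x metric \<Rightarrow> ('x \<Rightarrow> 'm) \<Rightarrow> ('x \<times> 'x) set" where
  "reeb_rel X f =
     {(x, x'). \<exists>c. connected_component_of (subtopology (mtopology_of X) (f -` {c})) x x'}"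

definition reeb_class :: "'x metric \<Rightarrow> ('x \<Rightarrow> 'm) \<Rightarrow> 'x \<Rightarrow> 'x set" where
  "reeb_class X f x = reeb_rel X f `` {x}"

definition reeb_space :: "'x metric \<Rightarrow> ('x \<Rightarrow> 'm) \<Rightarrow> 'x set set" where
  "reeb_space X f = mspace X // reeb_rel X f"

definition reeb_rep :: "'x set \<Rightarrow> 'x" where
  "reeb_rep P = (SOME x. x \<in> P)"

text \<open>
  The value \<open>0\<close> outside the carrier is only there because \<open>Metric_space\<close> demands symmetry and
  nonnegativity of the distance on the whole type.
\<close>

definition reeb_dist ::
    "'m metric \<Rightarrow> 'x metric \<Rightarrow> ('x \<Rightarrow> 'm) \<Rightarrow> 'x set \<Rightarrow> 'x set \<Rightarrow> real" where
  "reeb_dist M X f P Q =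
     (if P \<in> reeb_space X f \<and> Q \<in> reeb_space X f
      then 2 * max (reeb_radius M X f (reeb_rep P) (reeb_rep Q))
                   (reeb_radius M X f (reeb_rep Q) (reeb_rep P))
      else 0)"

definition reeb_metric :: "'m metric \<Rightarrow> 'x metric \<Rightarrow> ('x \<Rightarrow> 'm) \<Rightarrow> 'x set metric" where
  "reeb_metric M X f = metric (reeb_space X f, reeb_dist M X f)"

definition reeb_decoration ::
    "'m metric \<Rightarrow> 'x metric \<Rightarrow> ('x \<Rightarrow> 'm) \<Rightarrow> 'x set \<Rightarrow> 'x metric \<times> ('x \<Rightarrow> real)" where
  "reeb_decoration M X f P = (X, reeb_radius M X f (reeb_rep P))"

definition correspondence :: "'a set \<Rightarrow> 'b set \<Rightarrow> ('a \<times> 'b) set \<Rightarrow> bool" where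
  "correspondence A B R \<longleftrightarrow> R \<subseteq> A \<times> B \<and> fst ` R = A \<and> snd ` R = B"

definition rs_correspondence ::
    "'m metric \<Rightarrow> real \<Rightarrow> real \<Rightarrow> 'x metric \<times> ('x \<Rightarrow> 'm) \<Rightarrow> 'y metric \<times> ('y \<Rightarrow> 'm)
      \<Rightarrow> ('x \<times> 'y) set \<Rightarrow> bool" where
  "rs_correspondence M r s = (\<lambda>(X, f) (Y, g) R.
     correspondence (mspace X) (mspace Y) R \<and>
     (\<forall>(x, y) \<in> R. \<forall>(x', y') \<in> R.
        \<bar>mdist X x x' - mdist Y y y'\<bar> \<le> 2 * r \<and> mdist M (f x) (g y) \<le> s))"

definition rst_correspondence ::
    "real \<Rightarrow> real \<Rightarrow> real
      \<Rightarrow> 'a metric \<times> ('a \<Rightarrow> 'x metric \<times> ('x \<Rightarrow> real))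
      \<Rightarrow> 'b metric \<times> ('b \<Rightarrow> 'y metric \<times> ('y \<Rightarrow> real))
      \<Rightarrow> ('a \<times> 'b) set \<Rightarrow> bool" where
  "rst_correspondence r s t = (\<lambda>(A, D\<^sub>A) (B, D\<^sub>B) S.
     correspondence (mspace A) (mspace B) S \<and>
     (\<forall>(a, b) \<in> S. \<forall>(a', b') \<in> S.
        \<bar>mdist A a a' - mdist B b b'\<bar> \<le> 2 * r \<and>
        (\<exists>R. rs_correspondence euclidean_metric s t (D\<^sub>A a) (D\<^sub>B b) R)))"

definition induced_correspondence ::
    "'x metric \<Rightarrow> ('x \<Rightarrow> 'm) \<Rightarrow> 'y metric \<Rightarrow> ('y \<Rightarrow> 'm)
      \<Rightarrow> ('x \<times> 'y) set \<Rightarrow> ('x set \<times> 'y set) set" where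
  "induced_correspondence X f Y g R = {(reeb_class X f x, reeb_class Y g y) | x y. (x, y) \<in> R}"


text \<open>Well-definedness of the Reeb space and its metric.\<close>

lemma reeb_rel_iff:
  "(x, y) \<in> reeb_rel X f \<longleftrightarrow>
     connected_component_of (subtopology (mtopology_of X) (f -` {f x})) x y"
proof
  assume "(x, y) \<in> reeb_rel X f"
  then obtain c where c: "connected_component_of (subtopology (mtopology_of X) (f -` {c})) x y"
    by (auto simp: reeb_rel_def)
  then have "f x = c"
    using connected_component_in_topspace[OF c] by auto
  with c show "connected_component_of (subtopology (mtopology_of X) (f -` {f x})) x y"
    by simp
qed (auto simp: reeb_rel_def)

lemma reeb_relD:
  assumes "(x, y) \<in> reeb_rel X f"
  shows "x \<in> mspace X" "y \<in> mspace X" "f x = f y"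
  using assms connected_component_in_topspace by (fastforce simp: reeb_rel_iff)+

lemma equiv_reeb_rel: "equiv (mspace X) (reeb_rel X f)"
proof (rule equivI)
  show "reeb_rel X f \<subseteq> mspace X \<times> mspace X"
    using reeb_relD by fastforce
  show "refl_on (mspace X) (reeb_rel X f)"
    by (auto simp: refl_on_def reeb_rel_iff connected_component_of_refl)
  show "sym (reeb_rel X f)"
    by (auto simp: sym_def reeb_rel_def connected_component_of_sym)
  show "trans (reeb_rel X f)"
  proof (rule transI)
    fix x y z
    assume "(x, y) \<in> reeb_rel X f" and "(y, z) \<in> reeb_rel X f"
    then show "(x, z) \<in> reeb_rel X f"
      using connected_component_of_trans reeb_relD(3) unfolding reeb_rel_iff[of x] reeb_rel_iff[of y]
      by (metis reeb_rel_iff)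
  qed
qed

lemma reeb_rep_class:
  assumes "x \<in> mspace X"
  shows "(x, reeb_rep (reeb_class X f x)) \<in> reeb_rel X f"
proof -
  have "x \<in> reeb_class X f x"
    using assms equiv_class_self[OF equiv_reeb_rel] by (simp add: reeb_class_def)
  then have "reeb_rep (reeb_class X f x) \<in> reeb_class X f x"
    unfolding reeb_rep_def by (rule someI)
  then show ?thesis
    by (simp add: reeb_class_def)
qed

context metric_field
begin

abbreviation "\<rho> \<equiv> reeb_radius M X f"
abbreviation "sublevel x a \<equiv> subtopology (mtopology_of X) {z. mdist M (f x) (f z) \<le> a}"

lemma f_in: "x \<in> mspace X \<Longrightarrow> f x \<in> mspace M"
  using continuous by (auto simp: continuous_map_def)

lemma height_self: "x \<in> mspace X \<Longrightarrow> mdist M (f x) (f x) = 0"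
  by (simp add: f_in)

lemma continuous_height:
  assumes "x \<in> mspace X"
  shows "continuous_map (mtopology_of X) euclideanreal (\<lambda>z. mdist M (f x) (f z))"
  using assms by (intro continuous_map_mdist continuous) (simp_all add: f_in)

lemma Hausdorff: "Hausdorff_space (mtopology_of X)"
  by (metis Metric_space.Hausdorff_space_mtopology Metric_space_mspace_mdist mtopology_of_def)

lemma path_bdd:
  assumes "x \<in> mspace X" "pathin (mtopology_of X) \<gamma>"
  shows "bdd_above ((\<lambda>t. mdist M (f x) (f (\<gamma> t))) ` {0..1})"
proof -
  have "continuous_map (subtopology euclideanreal {0..1}) euclideanreal
          ((\<lambda>z. mdist M (f x) (f z)) \<circ> \<gamma>)"
    using assms continuous_height continuous_map_compose unfolding pathin_def by blast
  then have "continuous_on {0..1} (\<lambda>t. mdist M (f x) (f (\<gamma> t)))"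
    by (simp add: o_def)
  then show ?thesis
    by (metis bounded_imp_bdd_above compact_Icc compact_continuous_image compact_imp_bounded)
qed

lemma paths_exist:
  assumes "x \<in> mspace X" "y \<in> mspace X"
  shows "{\<gamma>. pathin (mtopology_of X) \<gamma> \<and> \<gamma> 0 = x \<and> \<gamma> 1 = y} \<noteq> {}"
proof -
  have "connected_component_of (mtopology_of X) x y"
    using assms connected by (simp add: connected_space_imp_connected_component_of)
  then have "path_component_of (mtopology_of X) x y"
    using path_component_eq_connected_component_of[OF locally_path_connected] by blast
  then show ?thesis
    by (auto simp: path_component_of_def)
qed

lemma sup_nonneg:
  assumes "x \<in> mspace X" "pathin (mtopology_of X) \<gamma>"
  shows "0 \<le> (SUP t \<in> {0..1}. mdist M (f x) (f (\<gamma> t)))"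
  by (rule cSUP_upper2[OF path_bdd[OF assms], of 0]) auto

lemma radius_le:
  assumes "path_component_of (sublevel x a) x y"
  shows "\<rho> x y \<le> a"
proof -
  obtain \<gamma> where \<gamma>: "pathin (sublevel x a) \<gamma>" "\<gamma> 0 = x" "\<gamma> 1 = y"
    using assms by (auto simp: path_component_of_def)
  have x: "x \<in> mspace X"
    using path_component_in_topspace[OF assms] by simp
  have "\<rho> x y \<le> (SUP t \<in> {0..1}. mdist M (f x) (f (\<gamma> t)))"
    unfolding reeb_radius_def
  proof (rule cINF_lower)
    show "bdd_below ((\<lambda>\<gamma>. SUP t \<in> {0..1}. mdist M (f x) (f (\<gamma> t))) `
            {\<gamma>. pathin (mtopology_of X) \<gamma> \<and> \<gamma> 0 = x \<and> \<gamma> 1 = y})"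
      using sup_nonneg[OF x] by (intro bdd_belowI2[of _ 0]) auto
  qed (use \<gamma> in \<open>auto simp: pathin_subtopology\<close>)
  also have "\<dots> \<le> a"
    using \<gamma>(1) by (intro cSUP_least) (auto simp: pathin_subtopology)
  finally show ?thesis .
qed

lemma radius_less:
  assumes "x \<in> mspace X" "y \<in> mspace X" "\<rho> x y < a"
  shows "path_component_of (sublevel x a) x y"
proof -
  obtain \<gamma> where \<gamma>: "pathin (mtopology_of X) \<gamma>" "\<gamma> 0 = x" "\<gamma> 1 = y"
    and less: "(SUP t \<in> {0..1}. mdist M (f x) (f (\<gamma> t))) < a"
  proof -
    have "(\<lambda>\<gamma>. SUP t \<in> {0..1}. mdist M (f x) (f (\<gamma> t))) `
            {\<gamma>. pathin (mtopology_of X) \<gamma> \<and> \<gamma> 0 = x \<and> \<gamma> 1 = y} \<noteq> {}"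
      using paths_exist[OF assms(1,2)] by blast
    from cInf_lessD[OF this assms(3)[unfolded reeb_radius_def]] that show ?thesis
      by blast
  qed
  have "mdist M (f x) (f (\<gamma> t)) \<le> a" if "t \<in> {0..1}" for t
    using cSUP_upper[OF that path_bdd[OF assms(1) \<gamma>(1)]] less by linarith
  with \<gamma> show ?thesis
    by (auto simp: path_component_of_def pathin_subtopology)
qed

lemma radius_ge_dist:
  assumes "x \<in> mspace X" "y \<in> mspace X"
  shows "mdist M (f x) (f y) \<le> \<rho> x y"
proof (rule dense_ge)
  fix a assume "\<rho> x y < a"
  from path_component_in_topspace[OF radius_less[OF assms this]]
  show "mdist M (f x) (f y) \<le> a" by simp
qed

lemma radius_nonneg:
  assumes "x \<in> mspace X" "y \<in> mspace X"
  shows "0 \<le> \<rho> x y"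
  by (rule order_trans[OF mdist_nonneg radius_ge_dist[OF assms]])

lemma radius_triangle:
  assumes "x \<in> mspace X" "y \<in> mspace X" "z \<in> mspace X"
  shows "\<rho> x z \<le> \<rho> x y + \<rho> y z"
proof (rule field_le_epsilon)
  fix e :: real assume "0 < e"
  define a where "a = \<rho> x y + e / 2"
  define b where "b = \<rho> y z + e / 2"
  have "path_component_of (sublevel x a) x y" "path_component_of (sublevel y b) y z"
    using assms \<open>0 < e\<close> by (auto intro!: radius_less simp: a_def b_def)
  then obtain S T where S: "path_connectedin (mtopology_of X) S" "S \<subseteq> {w. mdist M (f x) (f w) \<le> a}"
      "x \<in> S" "y \<in> S"
    and T: "path_connectedin (mtopology_of X) T" "T \<subseteq> {w. mdist M (f y) (f w) \<le> b}"
      "y \<in> T" "z \<in> T"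
    unfolding path_component_of path_connectedin_subtopology by blast
  have "0 \<le> b"
    using radius_nonneg[OF assms(2,3)] \<open>0 < e\<close> by (simp add: b_def)
  then have "S \<subseteq> {w. mdist M (f x) (f w) \<le> a + b}"
    using S(2) by auto
  moreover have "mdist M (f x) (f w) \<le> a + b" if "w \<in> T" for w
  proof -
    have w: "w \<in> mspace X" "mdist M (f y) (f w) \<le> b"
      using that T(2) path_connectedin_subset_topspace[OF T(1)] by auto
    have "mdist M (f x) (f w) \<le> mdist M (f x) (f y) + mdist M (f y) (f w)"
      using assms w by (intro mdist_triangle f_in)
    then show ?thesis
      using radius_ge_dist[OF assms(1,2)] w(2) \<open>0 < e\<close> by (simp add: a_def)
  qed
  ultimately have "path_component_of (sublevel x (a + b)) x y"
      "path_component_of (sublevel x (a + b)) y z"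
    using S T unfolding path_component_of path_connectedin_subtopology by blast+
  then have "path_component_of (sublevel x (a + b)) x z"
    by (rule path_component_of_trans)
  from radius_le[OF this] show "\<rho> x z \<le> \<rho> x y + \<rho> y z + e"
    by (simp add: a_def b_def)
qed

lemma radius_eq_0_if_rel:
  assumes "(x, y) \<in> reeb_rel X f"
  shows "\<rho> x y = 0"
proof (rule antisym)
  note D = reeb_relD[OF assms]
  show "\<rho> x y \<le> 0"
  proof (rule dense_ge)
    fix a :: real assume "0 < a"
    define U where "U = {z \<in> mspace X. mdist M (f x) (f z) < a}"
    have "openin (mtopology_of X) U"
      using openin_continuous_map_preimage[OF continuous_height[OF D(1)], of "{..<a}"]
      by (simp add: U_def)
    then have lpc: "locally_path_connected_space (subtopology (mtopology_of X) U)"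
      using locally_path_connected locally_path_connected_space_open_subset by blast
    obtain T where T: "connectedin (mtopology_of X) T" "T \<subseteq> f -` {f x}" "x \<in> T" "y \<in> T"
      using assms by (auto simp: reeb_rel_iff connected_component_of_def connectedin_subtopology)
    have "T \<subseteq> U"
    proof
      fix z assume "z \<in> T"
      then have "z \<in> mspace X" "f z = f x"
        using T(2) connectedin_subset_topspace[OF T(1)] by auto
      then show "z \<in> U"
        using \<open>0 < a\<close> D(1) by (simp add: U_def height_self)
    qed
    with T have "connected_component_of (subtopology (mtopology_of X) U) x y"
      by (auto simp: connected_component_of_def connectedin_subtopology)
    then have "path_component_of (subtopology (mtopology_of X) U) x y"
      using path_component_eq_connected_component_of[OF lpc] by blast
    then have "path_component_of (sublevel x a) x y"
      by (auto simp: path_component_of_def pathin_subtopology U_def less_imp_le)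
    then show "\<rho> x y \<le> a"
      by (rule radius_le)
  qed
  show "0 \<le> \<rho> x y"
    by (rule radius_nonneg[OF D(1,2)])
qed

lemma rel_if_radius_eq_0:
  assumes "x \<in> mspace X" "y \<in> mspace X" "\<rho> x y = 0"
  shows "(x, y) \<in> reeb_rel X f"
proof -
  define T where "T = mtopology_of X"
  define h where "h = (\<lambda>z. mdist M (f x) (f z))"
  define K where "K = {z \<in> mspace X. h z = 0}"
  have h: "continuous_map T euclideanreal h"
    unfolding T_def h_def by (rule continuous_height[OF assms(1)])
  have K_eq: "K = mspace X \<inter> f -` {f x}"
    using assms(1) f_in by (auto simp: K_def h_def)
  have subK: "subtopology T K = subtopology (mtopology_of X) (f -` {f x})"
    by (metis K_eq T_def subtopology_restrict topspace_mtopology_of)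
  have topT: "topspace T = mspace X"
    by (simp add: T_def)
  have clK: "closedin T K"
    using closedin_continuous_map_preimage[OF h, of "{0}"] by (simp add: K_def topT)
  have "compact_space (subtopology T K)"
    using clK compact by (simp add: T_def closedin_compact_space compact_space_subtopology)
  moreover have "Hausdorff_space (subtopology T K)"
    using Hausdorff by (simp add: T_def Hausdorff_space_subtopology)
  ultimately have quasi: "quasi_component_of (subtopology T K) x
      = connected_component_of (subtopology T K) x"
    by (intro quasi_eq_connected_component_of) auto
  have xK: "x \<in> K"
    using assms(1) by (simp add: K_def h_def height_self)
  have yK: "y \<in> K"
    using radius_ge_dist[OF assms(1,2)] assms(2,3) by (simp add: K_def h_def order_antisym)
  have "quasi_component_of (subtopology T K) x y"
  proof (rule ccontr)
    assume "\<not> ?thesis"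
    then obtain S where S: "x \<in> S" "y \<notin> S" "closedin (subtopology T K) S" "openin (subtopology T K) S"
      using xK yK clK by (auto simp: quasi_component_of topT K_def)
    have "closedin T S"
      using S(3) clK closedin_trans_full by blast
    moreover have "closedin (subtopology T K) (K - S)"
      using S(4) clK by (metis closedin_def closedin_subset closedin_topspace
          openin_closedin_eq topspace_subtopology_subset)
    then have "closedin T (K - S)"
      using clK closedin_trans_full by blast
    moreover have "normal_space T"
      using compact Hausdorff by (simp add: T_def compact_Hausdorff_or_regular_imp_normal_space)
    moreover have "disjnt S (K - S)"
      by (simp add: disjnt_def)
    ultimately obtain U V where UV: "openin T U" "openin T V" "S \<subseteq> U" "K - S \<subseteq> V" "disjnt U V"
      unfolding normal_space_def by metis
    define C where "C = topspace T - (U \<union> V)"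
    have "closedin T C"
      unfolding C_def using UV by blast
    then have "compactin T C"
      using compact by (simp add: T_def closedin_compact_space)
    then have "compact (h ` C)"
      using h image_compactin by fastforce
    moreover have hC: "0 < h z" if "z \<in> C" for z
    proof -
      have "z \<notin> K" "z \<in> mspace X"
        using that UV by (auto simp: C_def topT)
      then have "h z \<noteq> 0"
        by (auto simp: K_def)
      then show ?thesis
        by (simp add: h_def less_le)
    qed
    ultimately obtain d where d: "0 < d" "\<And>z. z \<in> C \<Longrightarrow> d \<le> h z"
    proof (cases "C = {}")
      case False
      with compact_attains_inf[OF \<open>compact (h ` C)\<close>] hC that show ?thesis
        by auto
    qed (use that[of 1] in auto)
    have "path_component_of (sublevel x (d / 2)) x y"
      using assms d(1) by (intro radius_less) auto
    then have "connected_component_of (sublevel x (d / 2)) x y"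
      by (rule path_imp_connected_component_of)
    then obtain E where E: "connectedin T E" "E \<subseteq> {z. h z \<le> d / 2}" "x \<in> E" "y \<in> E"
      by (auto simp: connected_component_of_def connectedin_subtopology T_def h_def)
    have "E \<subseteq> U \<union> V"
    proof
      fix z assume "z \<in> E"
      then have "h z < d" "z \<in> topspace T"
        using E(2) d(1) connectedin_subset_topspace[OF E(1)] by fastforce+
      then show "z \<in> U \<union> V"
        using d(2)[of z] by (auto simp: C_def)
    qed
    moreover have "U \<inter> V \<inter> E = {}"
      using UV(5) by (auto simp: disjnt_def)
    moreover have "U \<inter> E \<noteq> {}" "V \<inter> E \<noteq> {}"
      using S(1,2) yK UV(3,4) E(3,4) by auto
    ultimately show False
      using E(1) UV(1,2) unfolding connectedin by metis
  qed
  then show ?thesis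
    using quasi by (simp add: reeb_rel_iff subK)
qed

lemma reeb_class_eq_iff:
  assumes "x \<in> mspace X" "y \<in> mspace X"
  shows "reeb_class X f x = reeb_class X f y \<longleftrightarrow> \<rho> x y = 0"
  using eq_equiv_class_iff[OF equiv_reeb_rel assms, of f] radius_eq_0_if_rel
    rel_if_radius_eq_0[OF assms] by (auto simp: reeb_class_def)

lemma radius_cong:
  assumes "(x, x') \<in> reeb_rel X f" "(y, y') \<in> reeb_rel X f"
  shows "\<rho> x y = \<rho> x' y'"
proof -
  have le: "\<rho> a b \<le> \<rho> a' b'" if "(a, a') \<in> reeb_rel X f" "(b, b') \<in> reeb_rel X f" for a a' b b'
  proof -
    have "(b', b) \<in> reeb_rel X f"
      using that(2) equiv_reeb_rel by (meson equivE symD)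
    then have "\<rho> a a' = 0" "\<rho> b' b = 0"
      using that(1) radius_eq_0_if_rel by auto
    moreover have "\<rho> a b \<le> \<rho> a a' + \<rho> a' b" "\<rho> a' b \<le> \<rho> a' b' + \<rho> b' b"
      using reeb_relD[OF that(1)] reeb_relD[OF that(2)] by (auto intro: radius_triangle)
    ultimately show ?thesis
      by linarith
  qed
  have "(x', x) \<in> reeb_rel X f" "(y', y) \<in> reeb_rel X f"
    using assms equiv_reeb_rel by (meson equivE symD)+
  then show ?thesis
    using le assms by (meson order_antisym)
qed

lemma reeb_space_eq: "reeb_space X f = reeb_class X f ` mspace X"
  by (auto simp: reeb_space_def reeb_class_def quotient_def)

lemma reeb_dist_class:
  assumes "x \<in> mspace X" "y \<in> mspace X"
  shows "reeb_dist M X f (reeb_class X f x) (reeb_class X f y) = 2 * max (\<rho> x y) (\<rho> y x)"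
proof -
  note reps = assms[THEN reeb_rep_class, of f]
  show ?thesis
    using assms radius_cong[OF reps] radius_cong[OF reps(2,1)]
    by (simp add: reeb_dist_def reeb_space_eq)
qed

lemma Metric_space_reeb: "Metric_space (reeb_space X f) (reeb_dist M X f)"
proof
  fix P Q R
  show "reeb_dist M X f P Q = reeb_dist M X f Q P"
    by (simp add: reeb_dist_def max.commute)
  show "0 \<le> reeb_dist M X f P Q"
  proof (cases "P \<in> reeb_space X f \<and> Q \<in> reeb_space X f")
    case True
    then obtain x y where "x \<in> mspace X" "y \<in> mspace X" "P = reeb_class X f x" "Q = reeb_class X f y"
      by (auto simp: reeb_space_eq)
    then show ?thesis
      using radius_nonneg[of x y] by (simp add: reeb_dist_class)
  qed (auto simp: reeb_dist_def)
  assume "P \<in> reeb_space X f" "Q \<in> reeb_space X f"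
  then obtain x y where xy: "x \<in> mspace X" "y \<in> mspace X"
    and PQ: "P = reeb_class X f x" "Q = reeb_class X f y"
    by (auto simp: reeb_space_eq)
  show "reeb_dist M X f P Q = 0 \<longleftrightarrow> P = Q"
    using reeb_class_eq_iff[OF xy] reeb_class_eq_iff[OF xy(2,1)] radius_nonneg[OF xy]
      radius_nonneg[OF xy(2,1)] reeb_dist_class[OF xy] unfolding PQ
    by (auto simp: max_def split: if_splits)
  assume "R \<in> reeb_space X f"
  then obtain z where z: "z \<in> mspace X" "R = reeb_class X f z"
    by (auto simp: reeb_space_eq)
  show "reeb_dist M X f P R \<le> reeb_dist M X f P Q + reeb_dist M X f Q R"
    using radius_triangle[OF xy z(1)] radius_triangle[OF z(1) xy(2,1)] xy z(1)
    unfolding PQ z(2) by (simp add: reeb_dist_class)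
qed

lemma mspace_reeb_metric: "mspace (reeb_metric M X f) = reeb_space X f"
  unfolding reeb_metric_def by (rule Metric_space.mspace_metric[OF Metric_space_reeb])

lemma mdist_reeb_metric:
  assumes "x \<in> mspace X" "y \<in> mspace X"
  shows "mdist (reeb_metric M X f) (reeb_class X f x) (reeb_class X f y) = 2 * max (\<rho> x y) (\<rho> y x)"
  using reeb_dist_class[OF assms]
  unfolding reeb_metric_def Metric_space.mdist_metric[OF Metric_space_reeb] .

lemma reeb_decoration_class:
  assumes "x \<in> mspace X" "y \<in> mspace X"
  shows "fst (reeb_decoration M X f (reeb_class X f x)) = X"
    and "snd (reeb_decoration M X f (reeb_class X f x)) y = \<rho> x y"
proof -
  have "(y, y) \<in> reeb_rel X f"
    using assms(2) equiv_reeb_rel by (meson equivE refl_onD)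
  then show "snd (reeb_decoration M X f (reeb_class X f x)) y = \<rho> x y"
    using radius_cong[OF reeb_rep_class[OF assms(1)]] by (simp add: reeb_decoration_def)
qed (simp add: reeb_decoration_def)

end

end

theory Submission
  imports Defs
begin

text \<open>
  Everything rests on one estimate: if \<open>x, x'\<close> correspond to \<open>y, y'\<close>, then
  \<open>\<rho>\<^sub>g y y' \<le> \<rho>\<^sub>f x x' + 2 L r + 2 s + 2 \<epsilon>\<close>.  To see it, take a path \<open>\<gamma>\<close> from \<open>x\<close> to \<open>x'\<close> that is
  almost optimal for \<open>\<rho>\<^sub>f x x'\<close>.  Two nearby points of \<open>\<gamma>\<close>, at distance less than \<open>\<eta>\<close>, have
  correspondents in \<open>Y\<close> at distance at most \<open>\<eta> + 2 r\<close>, so by \<open>(L,\<epsilon>)\<close>-connectivity of \<open>g\<close> these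
  correspondents are joined by a path along which \<open>g\<close> deviates from its initial value by little more than
  \<open>L (\<eta> + 2 r) + 2 \<epsilon>\<close>.  That initial value is in turn within \<open>\<rho>\<^sub>f x x' + 2 s\<close> of \<open>g y\<close>, up to
  an arbitrarily small error, since \<open>f\<close> and \<open>g\<close> differ by at most \<open>s\<close> at corresponding points.
  Chaining such short steps along \<open>\<gamma>\<close> joins \<open>y\<close> to \<open>y'\<close> inside a sublevel set of
  \<open>\<lambda>z. d\<^sub>M (g y) (g z)\<close>, which bounds \<open>\<rho>\<^sub>g y y'\<close>; this is \<open>radius_le_radius_correspondent\<close>.

  The situation is symmetric in the two fields, so Reeb radii of corresponding pairs differ by at most
  \<open>2 L r + 2 s + 2 \<epsilon>\<close>.  Hence the given correspondence itself compares the decorations of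
  corresponding classes, and the factor 2 in the Reeb metric matches the factor 2 with which
  distortion is measured.
\<close>

lemma rs_correspondenceD:
  assumes "rs_correspondence M r s (X, f) (Y, g) R"
  shows "(x, y) \<in> R \<Longrightarrow> x \<in> mspace X" "(x, y) \<in> R \<Longrightarrow> y \<in> mspace Y"
    and "x \<in> mspace X \<Longrightarrow> \<exists>y. (x, y) \<in> R"
    and "(x, y) \<in> R \<Longrightarrow> mdist M (f x) (g y) \<le> s"
    and "(x, y) \<in> R \<Longrightarrow> (x', y') \<in> R \<Longrightarrow> \<bar>mdist X x x' - mdist Y y y'\<bar> \<le> 2 * r"
proof -
  have "R \<subseteq> mspace X \<times> mspace Y" "fst ` R = mspace X"
    using assms by (simp_all add: rs_correspondence_def correspondence_def)
  then show "(x, y) \<in> R \<Longrightarrow> x \<in> mspace X" "(x, y) \<in> R \<Longrightarrow> y \<in> mspace Y"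
    and "x \<in> mspace X \<Longrightarrow> \<exists>y. (x, y) \<in> R"
    by auto force
  show "(x, y) \<in> R \<Longrightarrow> mdist M (f x) (g y) \<le> s"
    and "(x, y) \<in> R \<Longrightarrow> (x', y') \<in> R \<Longrightarrow> \<bar>mdist X x x' - mdist Y y y'\<bar> \<le> 2 * r"
    using assms unfolding rs_correspondence_def prod.case by blast+
qed

lemma rs_correspondence_converse:
  assumes "rs_correspondence M r s (X, f) (Y, g) R"
  shows "rs_correspondence M r s (Y, g) (X, f) (R\<inverse>)"
proof -
  have "correspondence (mspace X) (mspace Y) R"
    using assms by (simp add: rs_correspondence_def)
  then have "correspondence (mspace Y) (mspace X) (R\<inverse>)"
    by (auto simp: correspondence_def image_iff Domain_fst[symmetric] Range_snd[symmetric])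
  then show ?thesis
    using rs_correspondenceD(4,5)[OF assms] unfolding rs_correspondence_def
    by (auto simp: abs_minus_commute mdist_commute[of M])
qed

context metric_field
begin

lemma path_component_of_sublevel_shift:
  assumes "path_component_of (sublevel u b) v w"
    and "z \<in> mspace X" "u \<in> mspace X" "mdist M (f z) (f u) + b \<le> c"
  shows "path_component_of (sublevel z c) v w"
proof -
  obtain S where S: "path_connectedin (mtopology_of X) S" "S \<subseteq> {p. mdist M (f u) (f p) \<le> b}"
      "v \<in> S" "w \<in> S"
    using assms(1) unfolding path_component_of path_connectedin_subtopology by blast
  have "mdist M (f z) (f p) \<le> c" if "p \<in> S" for p
  proof -
    have p: "p \<in> mspace X" "mdist M (f u) (f p) \<le> b"
      using that S(2) path_connectedin_subset_topspace[OF S(1)] by auto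
    have "mdist M (f z) (f p) \<le> mdist M (f z) (f u) + mdist M (f u) (f p)"
      using assms p by (intro mdist_triangle f_in)
    with p(2) assms(4) show ?thesis by linarith
  qed
  with S show ?thesis
    unfolding path_component_of path_connectedin_subtopology by blast
qed

end

text \<open>
  Instead of subdividing the path \<open>\<gamma>\<close>, the chaining is done by connectedness of its parameter interval:
  lying in one path component of the sublevel set, for all correspondents of two points of \<open>\<gamma>\<close>, is a
  symmetric and transitive relation between parameters that holds locally, hence globally.
  Transitivity uses that every point of \<open>\<gamma>\<close> has a correspondent.
\<close>

lemma radius_le_radius_correspondent:
  assumes "0 \<le> L" and "metric_field M X f" and "metric_field M Y g"
    and conn: "has_connectivity L \<epsilon> M Y g"
    and R: "rs_correspondence M r s (X, f) (Y, g) R"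
    and xy: "(x, y) \<in> R" "(x', y') \<in> R"
  shows "reeb_radius M Y g y y' \<le> reeb_radius M X f x x' + (2 * L * r + 2 * s + 2 * \<epsilon>)"
proof (rule field_le_epsilon)
  interpret X: metric_field M X f by fact
  interpret Y: metric_field M Y g by fact
  note RD = rs_correspondenceD[OF R]
  fix e :: real assume "0 < e"
  define a where "a = X.\<rho> x x' + e / 4"
  \<comment> \<open>The denominator is \<open>L + 1\<close> rather than \<open>L\<close> to cover \<open>L = 0\<close>.\<close>
  define \<eta> where "\<eta> = e / (2 * (L + 1))"
  have \<eta>: "0 < \<eta>" "L * \<eta> \<le> e / 2"
    using \<open>0 \<le> L\<close> \<open>0 < e\<close> by (auto simp: \<eta>_def field_simps)
  define b where "b = L * (\<eta> + 2 * r) + 2 * \<epsilon> + e / 4"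
  define c where "c = a + 2 * s + b"
  have "path_component_of (X.sublevel x a) x x'"
    using xy \<open>0 < e\<close> by (auto intro!: X.radius_less RD(1) simp: a_def)
  then obtain \<gamma> where \<gamma>: "pathin (mtopology_of X) \<gamma>" "\<gamma> 0 = x" "\<gamma> 1 = x'"
    and low: "\<And>t. t \<in> {0..1} \<Longrightarrow> mdist M (f x) (f (\<gamma> t)) \<le> a"
    by (auto simp: path_component_of_def pathin_subtopology)
  have \<gamma>_in: "\<gamma> t \<in> mspace X" if "t \<in> {0..1}" for t
    using path_image_subset_topspace[OF \<gamma>(1)] that by auto
  have step: "path_component_of (Y.sublevel y c) v w"
    if "(\<gamma> t, v) \<in> R" "(\<gamma> t', w) \<in> R" "t \<in> {0..1}" "mdist X (\<gamma> t) (\<gamma> t') < \<eta>" for t t' v w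
  proof (rule Y.path_component_of_sublevel_shift)
    have "mdist Y v w \<le> \<eta> + 2 * r"
      using RD(5)[OF that(1,2)] that(4) by linarith
    then have "L * mdist Y v w \<le> L * (\<eta> + 2 * r)"
      using \<open>0 \<le> L\<close> by (rule mult_left_mono)
    moreover have "Y.\<rho> v w \<le> L * mdist Y v w + 2 * \<epsilon>"
      using conn RD(2) that by (auto simp: has_connectivity_def)
    ultimately have "Y.\<rho> v w < b"
      using \<open>0 < e\<close> by (simp add: b_def)
    then show "path_component_of (Y.sublevel v b) v w"
      using RD(2) that by (intro Y.radius_less) auto
    show y: "y \<in> mspace Y" and v: "v \<in> mspace Y"
      using RD(2) xy that by auto
    have "mdist M (g y) (g v) \<le> mdist M (g y) (f x) + mdist M (f x) (g v)"
      using y v RD(1)[OF xy(1)] by (intro mdist_triangle X.f_in Y.f_in)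
    also have "mdist M (f x) (g v) \<le> mdist M (f x) (f (\<gamma> t)) + mdist M (f (\<gamma> t)) (g v)"
      using v \<gamma>_in[OF that(3)] RD(1)[OF xy(1)] by (intro mdist_triangle X.f_in Y.f_in)
    finally show "mdist M (g y) (g v) + b \<le> c"
      using RD(4)[OF xy(1)] RD(4)[OF that(1)] low[OF that(3)]
      by (simp add: c_def mdist_commute)
  qed
  define E where "E = (\<lambda>t t'. \<forall>v w. (\<gamma> t, v) \<in> R \<longrightarrow> (\<gamma> t', w) \<in> R \<longrightarrow>
    path_component_of (Y.sublevel y c) v w)"
  have "E 0 1"
  proof (rule connected_equivalence_relation[of "{0..1::real}"])
    show "E t' t" if "E t t'" for t t'
      using that path_component_of_sym unfolding E_def by metis
    show "E t t''" if "E t t'" "E t' t''" "t' \<in> {0..1}" for t t' t''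
      using that RD(3)[OF \<gamma>_in[OF that(3)]] path_component_of_trans unfolding E_def by metis
    fix t :: real assume t: "t \<in> {0..1}"
    define T where "T = {t' \<in> {0..1}. mdist X (\<gamma> t) (\<gamma> t') < \<eta>}"
    have "continuous_map (top_of_set {0..1}) euclideanreal (\<lambda>t'. mdist X (\<gamma> t) (\<gamma> t'))"
      using \<gamma>(1) \<gamma>_in[OF t] unfolding pathin_def
      by (intro continuous_map_mdist) simp_all
    from openin_continuous_map_preimage[OF this, of "{..<\<eta>}"]
    have "openin (top_of_set {0..1}) T"
      by (simp add: T_def)
    moreover have "mdist X (\<gamma> t) (\<gamma> t) = 0"
      using \<gamma>_in[OF t] by simp
    then have "t \<in> T"
      using t \<eta>(1) by (simp add: T_def)
    moreover have "E t t'" if "t' \<in> T" for t'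
      using that step t by (auto simp: E_def T_def)
    ultimately show "\<exists>T. openin (top_of_set {0..1}) T \<and> t \<in> T \<and> (\<forall>t'\<in>T. E t t')"
      by blast
  qed auto
  then have "Y.\<rho> y y' \<le> c"
    using xy \<gamma> by (intro Y.radius_le) (auto simp: E_def)
  also have "c \<le> X.\<rho> x x' + (2 * L * r + 2 * s + 2 * \<epsilon>) + e"
    using \<eta>(2) by (simp add: c_def b_def a_def algebra_simps)
  finally show "Y.\<rho> y y' \<le> \<dots>" .
qed

lemma abs_radius_diff_correspondent_le:
  assumes "0 \<le> L" and "metric_field M X f" and "metric_field M Y g"
    and "has_connectivity L \<epsilon> M X f" and "has_connectivity L \<epsilon> M Y g"
    and "rs_correspondence M r s (X, f) (Y, g) R"
    and "(x, y) \<in> R" "(x', y') \<in> R"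
  shows "\<bar>reeb_radius M X f x x' - reeb_radius M Y g y y'\<bar> \<le> 2 * L * r + 2 * s + 2 * \<epsilon>"
proof -
  have "reeb_radius M Y g y y' \<le> reeb_radius M X f x x' + (2 * L * r + 2 * s + 2 * \<epsilon>)"
    by (rule radius_le_radius_correspondent) (use assms in auto)
  moreover have "reeb_radius M X f x x' \<le> reeb_radius M Y g y y' + (2 * L * r + 2 * s + 2 * \<epsilon>)"
    by (rule radius_le_radius_correspondent[OF assms(1,3,2,4) rs_correspondence_converse[OF assms(6)]])
      (use assms in auto)
  ultimately show ?thesis
    by linarith
qed

lemma correspondence_induced:
  assumes "correspondence (mspace X) (mspace Y) R"
  shows "correspondence (reeb_class X f ` mspace X) (reeb_class Y g ` mspace Y)
    (induced_correspondence X f Y g R)"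
proof -
  have R: "R \<subseteq> mspace X \<times> mspace Y" "fst ` R = mspace X" "snd ` R = mspace Y"
    using assms by (auto simp: correspondence_def)
  have eq: "induced_correspondence X f Y g R = map_prod (reeb_class X f) (reeb_class Y g) ` R"
    by (force simp: induced_correspondence_def)
  have "fst ` map_prod (reeb_class X f) (reeb_class Y g) ` R = reeb_class X f ` fst ` R"
      "snd ` map_prod (reeb_class X f) (reeb_class Y g) ` R = reeb_class Y g ` snd ` R"
    by (simp_all add: image_image)
  with R(1) show ?thesis
    unfolding correspondence_def eq R(2,3) by auto
qed

theorem theorem15:
  fixes M :: "'m metric" and X :: "'x metric" and Y :: "'y metric"
    and f :: "'x \<Rightarrow> 'm" and g :: "'y \<Rightarrow> 'm"
    and L \<epsilon> r s :: real and R :: "('x \<times> 'y) set"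
  assumes "0 \<le> L" and "0 \<le> \<epsilon>"
    and "metric_field M X f" and "metric_field M Y g"
    and "has_connectivity L \<epsilon> M X f" and "has_connectivity L \<epsilon> M Y g"
    and "0 \<le> r" and "0 \<le> s"
    and "rs_correspondence M r s (X, f) (Y, g) R"
  shows "rst_correspondence (2 * L * r + 2 * s + 2 * \<epsilon>) r (2 * L * r + 2 * s + 2 * \<epsilon>)
           (reeb_metric M X f, reeb_decoration M X f)
           (reeb_metric M Y g, reeb_decoration M Y g)
           (induced_correspondence X f Y g R)"
proof -
  interpret X: metric_field M X f by fact
  interpret Y: metric_field M Y g by fact
  define K where "K = 2 * L * r + 2 * s + 2 * \<epsilon>"
  note RD = rs_correspondenceD[OF assms(9)]
  have corr: "correspondence (mspace X) (mspace Y) R"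
    using assms(9) by (simp add: rs_correspondence_def)
  have close: "\<bar>X.\<rho> x x' - Y.\<rho> y y'\<bar> \<le> K" if "(x, y) \<in> R" "(x', y') \<in> R" for x y x' y'
    unfolding K_def by (rule abs_radius_diff_correspondent_le[OF assms(1,3-6,9) that])
  have dist: "\<bar>mdist (reeb_metric M X f) (reeb_class X f x) (reeb_class X f x')
      - mdist (reeb_metric M Y g) (reeb_class Y g y) (reeb_class Y g y')\<bar> \<le> 2 * K"
    if "(x, y) \<in> R" "(x', y') \<in> R" for x y x' y'
    using close[OF that] close[OF that(2,1)] RD(1,2) that
    by (simp add: X.mdist_reeb_metric Y.mdist_reeb_metric)
  have deco: "rs_correspondence euclidean_metric r K (reeb_decoration M X f (reeb_class X f x))
      (reeb_decoration M Y g (reeb_class Y g y)) R" if xy: "(x, y) \<in> R" for x y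
  proof -
    define p where "p = snd (reeb_decoration M X f (reeb_class X f x))"
    define q where "q = snd (reeb_decoration M Y g (reeb_class Y g y))"
    have eqs: "reeb_decoration M X f (reeb_class X f x) = (X, p)"
        "reeb_decoration M Y g (reeb_class Y g y) = (Y, q)"
      by (simp_all add: p_def q_def reeb_decoration_def)
    have "\<bar>p x' - q y'\<bar> \<le> K" if "(x', y') \<in> R" for x' y'
      using close[OF xy that] RD(1,2) xy that
      by (simp add: p_def q_def X.reeb_decoration_class Y.reeb_decoration_class)
    then show ?thesis
      unfolding eqs rs_correspondence_def using corr RD(5) by (auto simp: dist_real_def)
  qed
  have "correspondence (mspace (reeb_metric M X f)) (mspace (reeb_metric M Y g))
      (induced_correspondence X f Y g R)"
    unfolding X.mspace_reeb_metric Y.mspace_reeb_metric X.reeb_space_eq Y.reeb_space_eq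
    by (rule correspondence_induced[OF corr])
  then show ?thesis
    unfolding rst_correspondence_def K_def[symmetric] prod.case induced_correspondence_def
    using dist deco by blast
qed

end
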